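(* Consider the fully composite problem $\varphi^*=\min_{x\in\operatorname{dom}\varphi}\{\varphi(x)=F(x,f(x))\}$ with subhomogeneous outer function (see context), where each component of $f$ is convex and twice continuously differentiable with Lipschitz continuous Hessian, and $F(L_2(f))<+\infty$. Let $x_0\in\operatorname{dom}\varphi$ and assume that the initial level set is bounded: $$D_0=\sup_x\{\|x-x^*\|:\varphi(x)\le\varphi(x_0)\}<+\infty.$$ Let $\alpha\ge1$, $M=\alpha F(L_2(f))$, and let $\{x_k\}$ be generated by the Fully Composite Cubic Newton Method $$x_{k+1}\in\operatorname*{argmin}_{y\in\operatorname{dom}\varphi}\Big\{F\big(y,\ \Omega_2(f,x_k;y)\big)+\tfrac M6\|y-x_k\|^3\Big\},\qquad k\ge0$$ (minimizers are assumed to exist). Then for all $k\ge1$, $$\varphi(x_k)-\varphi^*\ \le\ \frac{9(1+\alpha)F(L_2(f))D_0^3}{2k^2}.$$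
   Context: $\mathbb{E}$ is a finite-dimensional real vector space with norm $\|x\|=\langle Bx,x\rangle^{1/2}$, where $B:\mathbb{E}\to\mathbb{E}^*$ is self-adjoint positive definite. Fully composite problem: $F:\mathbb{E}\times\mathbb{R}^m\to\mathbb{R}\cup\{+\infty\}$ is closed and convex, and for every $x$ the function $F(x,\cdot)$ is monotone: $u\le v$ componentwise implies $F(x,u)\le F(x,v)$. $f=(f_1,\dots,f_m)^T:\operatorname{dom} f\to\mathbb{R}^m$ with $\operatorname{dom} f\subseteq\mathbb{E}$ open convex, and all $f_i$ closed and convex. $\varphi(x)=F(x,f(x))$, $\operatorname{dom}\varphi=\{x\in\operatorname{dom} f:F(x,f(x))<+\infty\}$ (with $\varphi=+\infty$ elsewhere), and a minimizer $x^*$ with $\varphi(x^* )=\varphi^*$ is assumed to exist. Subhomogeneity: for every $x\in\operatorname{dom}\varphi$, $F(x,\cdot)$ is finite on all of $\mathbb{R}^m$ and $F(x,u+tv)\le F(x,u)+tF(x,v)$ for all $u,v\in\mathbb{R}^m$, $t\ge0$. $\Omega_2(f,x;y)=f(x)+\langle\nabla f(x),y-x\rangle+\frac12\langle\nabla^2f(x)(y-x),y-x\rangle$ (componentwise). $L_2(f_i)<+\infty$ is a constant with $\|\nabla^2f_i(x)-\nabla^2f_i(y)\|\le L_2(f_i)\|x-y\|$ on $\operatorname{dom} f$, where $\|H\|=\max\{\langle Hh_1,h_2\rangle:\|h_1\|,\|h_2\|\le1\}$; $L_2(f)=(L_2(f_1),\dots,L_2(f_m))^T$. Notation: $F(L_2(f))=\sup_{x\in\operatorname{dom}\varphi}F(x,L_2(f))$.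 *)

theory Defs
  imports "HOL-Analysis.Analysis"
begin

text \<open>
  The dual space is the type of (bounded) linear functionals \<open>'a \<Rightarrow>\<^sub>L real\<close>, so the dual pairing is
  function application.  An operator from the space to its dual, such as \<open>B\<close> or a Hessian, is
  \<open>H :: 'a \<Rightarrow>\<^sub>L 'a \<Rightarrow>\<^sub>L real\<close>, and \<open>H u v\<close> stands for the pairing of \<open>H u\<close> with \<open>v\<close>.
  The norm of the type \<open>'a\<close> itself is used only for its topology (all norms being
  equivalent in finite dimension); every metric quantity below refers to the norm induced by \<open>B\<close>.
\<close>

definition self_adjoint_op :: "('a::euclidean_space \<Rightarrow>\<^sub>L 'a \<Rightarrow>\<^sub>L real) \<Rightarrow> bool" where
  "self_adjoint_op B \<longleftrightarrow> (\<forall>u v. B u v = B v u)"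

definition pos_def_op :: "('a::euclidean_space \<Rightarrow>\<^sub>L 'a \<Rightarrow>\<^sub>L real) \<Rightarrow> bool" where
  "pos_def_op B \<longleftrightarrow> (\<forall>u. u \<noteq> 0 \<longrightarrow> B u u > 0)"

definition bnorm :: "('a::euclidean_space \<Rightarrow>\<^sub>L 'a \<Rightarrow>\<^sub>L real) \<Rightarrow> 'a \<Rightarrow> real" where
  "bnorm B u = sqrt (B u u)"

text \<open>
  The supremum is over a nonempty set which, for self-adjoint positive definite \<open>B\<close>, is compact,
  so it is a maximum.
\<close>

definition op_bnorm ::
  "('a::euclidean_space \<Rightarrow>\<^sub>L 'a \<Rightarrow>\<^sub>L real) \<Rightarrow> ('a \<Rightarrow>\<^sub>L 'a \<Rightarrow>\<^sub>L real) \<Rightarrow> real" where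
  "op_bnorm B H = Sup {H h1 h2 | h1 h2. bnorm B h1 \<le> 1 \<and> bnorm B h2 \<le> 1}"

text \<open>Analogue of \<^const>\<open>epigraph\<close> for extended-valued functions.\<close>

definition ext_epigraph :: "('b \<Rightarrow> ereal) \<Rightarrow> ('b \<times> real) set" where
  "ext_epigraph G = {(z, t). G z \<le> ereal t}"

definition ext_closed_convex :: "('b::real_normed_vector \<Rightarrow> ereal) \<Rightarrow> bool" where
  "ext_closed_convex G \<longleftrightarrow> closed (ext_epigraph G) \<and> convex (ext_epigraph G)"

definition closed_convex_on :: "'a::real_normed_vector set \<Rightarrow> ('a \<Rightarrow> real) \<Rightarrow> bool" where
  "closed_convex_on D h \<longleftrightarrow> closed (epigraph D h) \<and> convex_on D h"

text \<open>
  The set \<open>D\<close> plays the role of the domain of the inner map \<open>f\<close>; the values of \<open>f\<close>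
  outside \<open>D\<close> are irrelevant.
\<close>

definition phi :: "('a \<Rightarrow> real^'m \<Rightarrow> ereal) \<Rightarrow> 'a set \<Rightarrow> ('a \<Rightarrow> real^'m) \<Rightarrow> 'a \<Rightarrow> ereal" where
  "phi F D f x = (if x \<in> D then F x (f x) else \<infinity>)"

definition dom_phi :: "('a \<Rightarrow> real^'m \<Rightarrow> ereal) \<Rightarrow> 'a set \<Rightarrow> ('a \<Rightarrow> real^'m) \<Rightarrow> 'a set" where
  "dom_phi F D f = {x \<in> D. F x (f x) < \<infinity>}"

definition subhomogeneous_on :: "'a set \<Rightarrow> ('a \<Rightarrow> real^'m \<Rightarrow> ereal) \<Rightarrow> bool" where
  "subhomogeneous_on S F \<longleftrightarrow>
     (\<forall>x\<in>S. (\<forall>u. \<bar>F x u\<bar> \<noteq> \<infinity>) \<and>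
            (\<forall>u v. \<forall>t\<ge>0. F x (u + t *\<^sub>R v) \<le> F x u + ereal t * F x v))"

definition sup_outer :: "('a \<Rightarrow> real^'m \<Rightarrow> ereal) \<Rightarrow> 'a set \<Rightarrow> real^'m \<Rightarrow> ereal" where
  "sup_outer F S u = (SUP x\<in>S. F x u)"

definition twice_cont_diff_on ::
  "'a::euclidean_space set \<Rightarrow> ('a \<Rightarrow> real) \<Rightarrow> ('a \<Rightarrow> 'a \<Rightarrow>\<^sub>L real) \<Rightarrow> ('a \<Rightarrow> 'a \<Rightarrow>\<^sub>L 'a \<Rightarrow>\<^sub>L real) \<Rightarrow> bool"
  where
  "twice_cont_diff_on D h g H \<longleftrightarrow>
     (\<forall>x\<in>D. (h has_derivative blinfun_apply (g x)) (at x)) \<and>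
     (\<forall>x\<in>D. (g has_derivative blinfun_apply (H x)) (at x)) \<and>
     continuous_on D H"

definition Omega2 ::
  "('a::euclidean_space \<Rightarrow> real^'m) \<Rightarrow> ('m \<Rightarrow> 'a \<Rightarrow> 'a \<Rightarrow>\<^sub>L real) \<Rightarrow>
   ('m \<Rightarrow> 'a \<Rightarrow> 'a \<Rightarrow>\<^sub>L 'a \<Rightarrow>\<^sub>L real) \<Rightarrow> 'a \<Rightarrow> 'a \<Rightarrow> real^'m" where
  "Omega2 f g H x y = (\<chi> i. f x $ i + g i x (y - x) + 1/2 * H i x (y - x) (y - x))"

end

theory Submission
  imports Defs
begin

text \<open>
  Lipschitz continuity of the Hessians makes \<open>f\<close> and its second-order model at \<open>x\<close> differ,
  component by component and in both directions, by at most \<open>L\<parallel>y - x\<parallel>\<^sup>3 / 6\<close>.  A monotone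
  subhomogeneous outer function turns such a componentwise error into an additive one, of size at
  most \<open>S \<parallel>y - x\<parallel>\<^sup>3 / 6\<close> with \<open>S = F(L\<^sub>2(f))\<close>.  Using this once at the new point, where
  \<open>M \<ge> S\<close> makes the regularized model an upper bound of \<open>\<phi>\<close>, and once at an arbitrary
  competitor \<open>y\<close> of the minimization gives
  \<open>\<phi>(x\<^sub>k\<^sub>+\<^sub>1) \<le> \<phi>(y) + (1 + \<alpha>) S \<parallel>y - x\<^sub>k\<parallel>\<^sup>3 / 6\<close>
  (lemma \<open>cubic_step_bound\<close>).

  The competitor \<open>y = x\<^sub>k\<close> shows that the method never leaves the initial level set, so
  \<open>\<parallel>x\<^sub>k - x\<^sup>*\<parallel> \<le> D\<^sub>0\<close>.  Since \<open>\<phi>\<close> is convex (lemma \<open>phi_convex\<close>), the competitors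
  \<open>y = (1 - a) x\<^sub>k + a x\<^sup>*\<close> give, for the residuals \<open>\<delta>\<^sub>k = \<phi>(x\<^sub>k) - \<phi>\<^sup>*\<close>,
  \<open>\<delta>\<^sub>k\<^sub>+\<^sub>1 \<le> (1 - a) \<delta>\<^sub>k + a\<^sup>3 E\<close> with \<open>E = (1 + \<alpha>) S D\<^sub>0\<^sup>3 / 6\<close> and any
  \<open>a \<in> [0, 1]\<close>.  The choice \<open>a = 3 / (k + 3)\<close> makes the weighted residuals
  \<open>k (k + 1) (k + 2) \<delta>\<^sub>k\<close> grow by at most \<open>27 E\<close> per step
  (lemma \<open>cubic_recursion_rate\<close>), whence \<open>\<delta>\<^sub>k \<le> 27 E / k\<^sup>2\<close>, which is the claim.
\<close>

section \<open>The norm induced by a positive definite operator\<close>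

lemma pos_def_op_nonneg: "pos_def_op B \<Longrightarrow> 0 \<le> B u u"
  by (cases "u = 0") (auto simp: pos_def_op_def less_imp_le)

lemma bnorm_nonneg: "pos_def_op B \<Longrightarrow> 0 \<le> bnorm B u"
  by (simp add: bnorm_def pos_def_op_nonneg)

lemma bnorm_scaleR: "bnorm B (c *\<^sub>R u) = \<bar>c\<bar> * bnorm B u"
proof -
  have "B (c *\<^sub>R u) (c *\<^sub>R u) = c\<^sup>2 * B u u"
    by (simp add: blinfun.scaleR_left blinfun.scaleR_right power2_eq_square)
  then show ?thesis
    by (simp add: bnorm_def real_sqrt_mult)
qed

lemma bnorm_pos: "pos_def_op B \<Longrightarrow> u \<noteq> 0 \<Longrightarrow> 0 < bnorm B u"
  by (simp add: bnorm_def pos_def_op_def)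

text \<open>The quadratic form of \<open>B\<close> attains a positive minimum on the compact unit sphere.\<close>

lemma bnorm_dominates_norm:
  fixes B :: "'a::euclidean_space \<Rightarrow>\<^sub>L 'a \<Rightarrow>\<^sub>L real"
  assumes "pos_def_op B"
  obtains c where "c > 0" "\<And>u. c * norm u \<le> bnorm B u"
proof -
  have "continuous_on (sphere 0 1) (bnorm B)"
    unfolding bnorm_def by (intro continuous_intros)
  moreover have "sphere (0::'a) 1 \<noteq> {}"
    by (simp add: sphere_eq_empty)
  ultimately obtain w where w: "w \<in> sphere 0 1" "\<And>v. v \<in> sphere 0 1 \<Longrightarrow> bnorm B w \<le> bnorm B v"
    using continuous_attains_inf[OF compact_sphere] by blast
  have "bnorm B w * norm u \<le> bnorm B u" for u
  proof (cases "u = 0")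
    case False
    have "bnorm B w \<le> bnorm B ((1 / norm u) *\<^sub>R u)"
      using False by (intro w) simp
    then show ?thesis
      using False by (simp add: bnorm_scaleR field_simps)
  qed (simp add: bnorm_def)
  moreover have "bnorm B w > 0"
    using w(1) assms by (intro bnorm_pos) auto
  ultimately show ?thesis using that by blast
qed

text \<open>
  A real supremum bounds the members of a set only if the set is bounded above.  Here the bound
  comes from comparing the norm of \<open>B\<close> with the ambient norm.
\<close>

lemma op_bnorm_upper:
  fixes B H :: "'a::euclidean_space \<Rightarrow>\<^sub>L 'a \<Rightarrow>\<^sub>L real"
  assumes "pos_def_op B" "bnorm B h1 \<le> 1" "bnorm B h2 \<le> 1"
  shows "H h1 h2 \<le> op_bnorm B H"
proof -
  obtain c where c: "c > 0" "\<And>u. c * norm u \<le> bnorm B u"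
    using bnorm_dominates_norm[OF assms(1)] by blast
  have bound: "norm u \<le> 1 / c" if "bnorm B u \<le> 1" for u
    using c(2)[of u] c(1) that by (simp add: field_simps)
  have "H u v \<le> norm H * (1 / c) * (1 / c)" if "bnorm B u \<le> 1" "bnorm B v \<le> 1" for u v
  proof -
    have "H u v \<le> norm (H u) * norm v"
      using norm_blinfun[of "H u" v] by simp
    also have "\<dots> \<le> (norm H * norm u) * norm v"
      by (intro mult_right_mono norm_blinfun) simp
    also have "\<dots> \<le> norm H * (1 / c) * (1 / c)"
      using c(1) bound that by (intro mult_mono) auto
    finally show ?thesis .
  qed
  then have "bdd_above {H h1 h2 | h1 h2. bnorm B h1 \<le> 1 \<and> bnorm B h2 \<le> 1}"
    by (auto intro!: bdd_aboveI)
  then show ?thesis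
    unfolding op_bnorm_def using assms by (intro cSup_upper) auto
qed

lemma op_bnorm_nonneg: "pos_def_op B \<Longrightarrow> 0 \<le> op_bnorm B H"
  using op_bnorm_upper[of B 0 0 H] by (simp add: bnorm_def)

lemma quadratic_form_le_op_bnorm:
  fixes B H :: "'a::euclidean_space \<Rightarrow>\<^sub>L 'a \<Rightarrow>\<^sub>L real"
  assumes "pos_def_op B"
  shows "H h h \<le> op_bnorm B H * (bnorm B h)\<^sup>2"
proof (cases "h = 0")
  case False
  define r where "r = bnorm B h"
  have r: "r > 0"
    using False assms by (simp add: r_def bnorm_pos)
  have "bnorm B ((1 / r) *\<^sub>R h) \<le> 1"
    using r by (simp add: bnorm_scaleR r_def)
  then have "H ((1 / r) *\<^sub>R h) ((1 / r) *\<^sub>R h) \<le> op_bnorm B H"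
    by (intro op_bnorm_upper assms)
  then show ?thesis
    using r by (simp add: blinfun.scaleR_left blinfun.scaleR_right field_simps power2_eq_square
        flip: r_def)
qed (simp add: bnorm_def)

text \<open>
  A Lipschitz constant can be negative only on a domain with at most one point, and a nonempty open
  set is never that small.
\<close>

lemma Lipschitz_const_nonneg:
  fixes B :: "'a::euclidean_space \<Rightarrow>\<^sub>L 'a \<Rightarrow>\<^sub>L real"
  assumes "pos_def_op B" "open D" "D \<noteq> {}"
    and "\<And>y z. y \<in> D \<Longrightarrow> z \<in> D \<Longrightarrow> op_bnorm B (H y - H z) \<le> l * bnorm B (y - z)"
  shows "0 \<le> l"
proof -
  obtain z where z: "z \<in> D"
    using assms by blast
  then have "infinite D"
    using assms(2,3) finite_imp_not_open by blast
  then obtain y where y: "y \<in> D" "y \<noteq> z"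
    by (metis finite.simps finite_subset insertCI subsetI)
  have "0 \<le> l * bnorm B (y - z)"
    using op_bnorm_nonneg[OF assms(1)] assms(4)[OF y(1) z] by (rule order_trans)
  moreover have "0 < bnorm B (y - z)"
    using y by (intro bnorm_pos assms) auto
  ultimately show ?thesis
    by (simp add: zero_le_mult_iff)
qed

section \<open>The second-order Taylor model\<close>

text \<open>
  The claim is \<open>p''(t) - p''(0) \<le> c t\<close> integrated twice from \<open>0\<close>; \<open>q\<close> is the slack.  The
  lower estimate is the same fact for \<open>- p\<close>.
\<close>

lemma cubic_taylor_upper:
  fixes p p' p'' :: "real \<Rightarrow> real"
  assumes p: "\<And>t. 0 \<le> t \<Longrightarrow> t \<le> 1 \<Longrightarrow> (p has_real_derivative p' t) (at t)"
    and p': "\<And>t. 0 \<le> t \<Longrightarrow> t \<le> 1 \<Longrightarrow> (p' has_real_derivative p'' t) (at t)"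
    and bound: "\<And>t. 0 \<le> t \<Longrightarrow> t \<le> 1 \<Longrightarrow> p'' t - p'' 0 \<le> c * t"
  shows "p 1 \<le> p 0 + p' 0 + p'' 0 / 2 + c / 6"
proof -
  define q where "q t = c * t ^ 3 / 6 - (p t - p' 0 * t - p'' 0 * t\<^sup>2 / 2)" for t
  define q' where "q' t = c * t\<^sup>2 / 2 - (p' t - p' 0 - p'' 0 * t)" for t
  have q: "(q has_real_derivative q' t) (at t)" if "0 \<le> t" "t \<le> 1" for t
    unfolding q_def q'_def
    by (auto intro!: derivative_eq_intros p that simp: power2_eq_square field_simps)
  have q': "(q' has_real_derivative c * t - (p'' t - p'' 0)) (at t)" if "0 \<le> t" "t \<le> 1" for t
    unfolding q'_def
    by (auto intro!: derivative_eq_intros p' that simp: field_simps)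
  have "q' 0 \<le> q' t" if "0 \<le> t" "t \<le> 1" for t
    using that bound by (intro DERIV_nonneg_imp_nondecreasing[of 0 t q'])
      (auto intro!: exI q' simp: le_diff_eq)
  then have "0 \<le> q' t" if "0 \<le> t" "t \<le> 1" for t
    using that by (simp add: q'_def)
  then have "q 0 \<le> q 1"
    using q by (intro DERIV_nonneg_imp_nondecreasing[of 0 1 q]) auto
  then show ?thesis
    by (simp add: q_def)
qed

text \<open>
  The one-dimensional estimate is applied along the segment from \<open>x\<close> to \<open>y\<close>, where the second
  derivative is the quadratic form of the Hessian in the fixed direction \<open>y - x\<close>.
\<close>

lemma second_order_model_error:
  fixes B :: "'a::euclidean_space \<Rightarrow>\<^sub>L 'a \<Rightarrow>\<^sub>L real"
  assumes B: "pos_def_op B"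
    and D: "convex D" "x \<in> D" "y \<in> D"
    and diff: "twice_cont_diff_on D h g H"
    and Lipschitz: "\<And>y z. y \<in> D \<Longrightarrow> z \<in> D \<Longrightarrow> op_bnorm B (H y - H z) \<le> l * bnorm B (y - z)"
  shows "\<bar>h y - (h x + g x (y - x) + 1/2 * H x (y - x) (y - x))\<bar> \<le> l * bnorm B (y - x) ^ 3 / 6"
proof -
  define d where "d = y - x"
  define p where "p t = h (x + t *\<^sub>R d)" for t :: real
  define p' where "p' t = g (x + t *\<^sub>R d) d" for t :: real
  define p'' where "p'' t = H (x + t *\<^sub>R d) d d" for t :: real
  have mem: "x + t *\<^sub>R d \<in> D" if "0 \<le> t" "t \<le> 1" for t
    using convexD_alt[OF D that] by (simp add: d_def algebra_simps)
  have line: "((\<lambda>t. x + t *\<^sub>R d) has_derivative (\<lambda>s. s *\<^sub>R d)) (at t)" for t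
    by (auto intro!: derivative_eq_intros)
  have p: "(p has_real_derivative p' t) (at t)" if "0 \<le> t" "t \<le> 1" for t
  proof -
    have "(h has_derivative blinfun_apply (g (x + t *\<^sub>R d))) (at (x + t *\<^sub>R d))"
      using diff mem[OF that] by (simp add: twice_cont_diff_on_def)
    from has_derivative_compose[OF line this] show ?thesis
      by (simp add: has_field_derivative_def p_def[abs_def] p'_def blinfun.scaleR_right mult.commute[of _ "g _ _"])
  qed
  have p': "(p' has_real_derivative p'' t) (at t)" if "0 \<le> t" "t \<le> 1" for t
  proof -
    have "(g has_derivative blinfun_apply (H (x + t *\<^sub>R d))) (at (x + t *\<^sub>R d))"
      using diff mem[OF that] by (simp add: twice_cont_diff_on_def)
    from bounded_linear.has_derivative[OF blinfun.bounded_linear_left has_derivative_compose[OF line this], of d]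
    show ?thesis
      by (simp add: has_field_derivative_def p'_def[abs_def] p''_def blinfun.scaleR_right blinfun.scaleR_left
          mult.commute[of _ "H _ _ _"])
  qed
  have curvature: "\<bar>p'' t - p'' 0\<bar> \<le> (l * bnorm B d ^ 3) * t" if t: "0 \<le> t" "t \<le> 1" for t
  proof -
    have *: "(H u - H v) d d \<le> (l * bnorm B d ^ 3) * t"
      if "u \<in> D" "v \<in> D" "bnorm B (u - v) = t * bnorm B d" for u v
    proof -
      have "(H u - H v) d d \<le> op_bnorm B (H u - H v) * (bnorm B d)\<^sup>2"
        by (rule quadratic_form_le_op_bnorm[OF B])
      also have "\<dots> \<le> (l * bnorm B (u - v)) * (bnorm B d)\<^sup>2"
        by (intro mult_right_mono Lipschitz that) simp
      finally show ?thesis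
        using that(3) by (simp add: power2_eq_square power3_eq_cube mult_ac)
    qed
    have "bnorm B ((x + t *\<^sub>R d) - x) = t * bnorm B d" "bnorm B (x - (x + t *\<^sub>R d)) = t * bnorm B d"
      using bnorm_scaleR[of B t d] bnorm_scaleR[of B "- t" d] t by simp_all
    from *[OF mem[OF t] D(2) this(1)] *[OF D(2) mem[OF t] this(2)] show ?thesis
      by (simp add: p''_def blinfun.diff_left abs_le_iff)
  qed
  have "p 1 \<le> p 0 + p' 0 + p'' 0 / 2 + (l * bnorm B d ^ 3) / 6"
    using curvature by (intro cubic_taylor_upper[of p p' p''] p p') (auto simp: abs_le_iff)
  moreover have "- p 1 \<le> - p 0 + - p' 0 + - p'' 0 / 2 + (l * bnorm B d ^ 3) / 6"
    using curvature p p'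
    by (intro cubic_taylor_upper[of "\<lambda>t. - p t" "\<lambda>t. - p' t" "\<lambda>t. - p'' t"])
      (auto simp: abs_le_iff intro!: derivative_intros)
  ultimately show ?thesis
    unfolding abs_le_iff by (simp add: p_def p'_def p''_def d_def)
qed

section \<open>Monotone subhomogeneous outer functions\<close>

text \<open>
  Subhomogeneity at \<open>u = v = 0\<close>, \<open>t = 1\<close> reads \<open>F z 0 \<le> 2 F z 0\<close>, so the finite value
  \<open>F z 0\<close> is nonnegative, and monotonicity carries this over to every \<open>v \<ge> 0\<close>.
\<close>

lemma sup_outer_nonneg:
  assumes mono: "\<And>z. mono (F z)"
    and subhom: "subhomogeneous_on S F"
    and "z \<in> S" "0 \<le> v"
  shows "0 \<le> sup_outer F S v"
proof -
  have "F z (0 + 1 *\<^sub>R 0) \<le> F z 0 + ereal 1 * F z 0"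
    using subhom \<open>z \<in> S\<close> zero_le_one unfolding subhomogeneous_on_def by blast
  moreover have "\<bar>F z 0\<bar> \<noteq> \<infinity>"
    using subhom \<open>z \<in> S\<close> by (simp add: subhomogeneous_on_def)
  ultimately have "0 \<le> F z 0"
    by (cases "F z 0") auto
  also have "\<dots> \<le> F z v"
    using mono \<open>0 \<le> v\<close> by (rule monoD)
  also have "\<dots> \<le> sup_outer F S v"
    unfolding sup_outer_def using \<open>z \<in> S\<close> by (rule SUP_upper)
  finally show ?thesis .
qed

text \<open>
  Monotonicity and subhomogeneity convert a one-sided error \<open>t *\<^sub>R v\<close> of the inner argument
  into an additive error of the value that is uniform over the domain.
\<close>

lemma outer_perturbation:
  assumes mono: "\<And>z. mono (F z)"
    and subhom: "subhomogeneous_on S F"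
    and sup: "sup_outer F S v = ereal s"
    and "z \<in> S" "0 \<le> t" "u \<le> w + t *\<^sub>R v"
  shows "F z u \<le> F z w + ereal (t * s)"
proof -
  have "F z v \<le> ereal s"
    unfolding sup[symmetric] sup_outer_def using \<open>z \<in> S\<close> by (rule SUP_upper)
  then have "ereal t * F z v \<le> ereal (t * s)"
    using \<open>0 \<le> t\<close> ereal_mult_left_mono[of "F z v" "ereal s" "ereal t"] by simp
  moreover have "F z u \<le> F z (w + t *\<^sub>R v)"
    using mono assms(6) by (rule monoD)
  moreover have "F z (w + t *\<^sub>R v) \<le> F z w + ereal t * F z v"
    using subhom \<open>z \<in> S\<close> \<open>0 \<le> t\<close> unfolding subhomogeneous_on_def by blast
  ultimately show ?thesis
    by (meson add_left_mono order_trans)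
qed

text \<open>
  The composition is convex because \<open>F\<close> is jointly convex and the convexity inequality of the
  inner map may be inserted into the monotone second argument.
\<close>

lemma phi_convex:
  fixes f :: "'a::euclidean_space \<Rightarrow> real^'m"
  assumes F: "ext_closed_convex (\<lambda>(z, u). F z u)" "\<And>z. mono (F z)"
    and D: "convex D" "y \<in> D" "z \<in> D"
    and f: "\<And>i. convex_on D (\<lambda>z. f z $ i)"
    and vals: "phi F D f y = ereal p" "phi F D f z = ereal q"
    and a: "0 \<le> a" "a \<le> 1"
  shows "phi F D f ((1 - a) *\<^sub>R y + a *\<^sub>R z) \<le> ereal ((1 - a) * p + a * q)"
proof -
  define w where "w = (1 - a) *\<^sub>R y + a *\<^sub>R z"
  have w: "w \<in> D"
    unfolding w_def using D a by (rule convexD_alt)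
  have "f w \<le> (1 - a) *\<^sub>R f y + a *\<^sub>R f z"
    using convex_onD[OF f a D(2,3)] by (simp add: less_eq_vec_def w_def)
  then have "F w (f w) \<le> F w ((1 - a) *\<^sub>R f y + a *\<^sub>R f z)"
    by (rule monoD[OF F(2)])
  also have "\<dots> \<le> ereal ((1 - a) * p + a * q)"
  proof -
    have "convex (ext_epigraph (\<lambda>(z, u). F z u))"
      using F(1) by (simp add: ext_closed_convex_def)
    moreover have "((y, f y), p) \<in> ext_epigraph (\<lambda>(z, u). F z u)"
      "((z, f z), q) \<in> ext_epigraph (\<lambda>(z, u). F z u)"
      using vals D by (auto simp: ext_epigraph_def phi_def)
    ultimately have "(1 - a) *\<^sub>R ((y, f y), p) + a *\<^sub>R ((z, f z), q) \<in> ext_epigraph (\<lambda>(z, u). F z u)"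
      using a by (intro convexD_alt)
    then show ?thesis
      by (simp add: ext_epigraph_def w_def)
  qed
  finally show ?thesis
    using w by (simp add: phi_def flip: w_def)
qed

section \<open>One step of the cubic Newton method\<close>

text \<open>
  The model error enters twice: at the new point \<open>xp\<close>, where it is absorbed by the regularization
  because \<open>\<alpha> \<ge> 1\<close>, and at the competitor \<open>y\<close>, where it adds to the regularization.
\<close>

lemma cubic_step_bound:
  fixes B :: "'a::euclidean_space \<Rightarrow>\<^sub>L 'a \<Rightarrow>\<^sub>L real"
    and F :: "'a \<Rightarrow> real^'m \<Rightarrow> ereal"
    and D :: "'a set"
    and f :: "'a \<Rightarrow> real^'m"
  defines "S \<equiv> dom_phi F D f"
  assumes B: "pos_def_op B"
    and F_mono: "\<And>z. mono (F z)"
    and D: "convex D"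
    and f_diff: "\<And>i. twice_cont_diff_on D (\<lambda>z. f z $ i) (g i) (H i)"
    and f_Lipschitz: "\<And>i y z. y \<in> D \<Longrightarrow> z \<in> D \<Longrightarrow>
                        op_bnorm B (H i y - H i z) \<le> L $ i * bnorm B (y - z)"
    and subhom: "subhomogeneous_on S F"
    and sup: "sup_outer F S L = ereal s" "0 \<le> s"
    and \<alpha>: "1 \<le> \<alpha>"
    and step: "is_arg_min (\<lambda>y. F y (Omega2 f g H x y) + ereal (\<alpha> * s * bnorm B (y - x) ^ 3 / 6))
                 (\<lambda>y. y \<in> S) xp"
    and x: "x \<in> S" and y: "y \<in> S"
  shows "phi F D f xp \<le> phi F D f y + ereal ((1 + \<alpha>) * s / 6 * bnorm B (y - x) ^ 3)"
proof -
  define r where "r z = bnorm B (z - x) ^ 3 / 6" for z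
  have r: "0 \<le> r z" for z
    by (simp add: r_def bnorm_nonneg[OF B])
  have xp: "xp \<in> S"
    using step by (simp add: is_arg_min_def)
  have SD: "z \<in> D" if "z \<in> S" for z
    using that by (simp add: S_def dom_phi_def)
  have err: "\<bar>f z $ i - Omega2 f g H x z $ i\<bar> \<le> r z * L $ i" if "z \<in> S" for z i
    using second_order_model_error[OF B D SD[OF x] SD[OF that] f_diff f_Lipschitz, of i]
    by (simp add: Omega2_def r_def mult.commute)
  have f_le: "f z \<le> Omega2 f g H x z + r z *\<^sub>R L" if "z \<in> S" for z
    unfolding less_eq_vec_def using err[OF that] by (simp add: abs_le_iff algebra_simps)
  have model_le: "Omega2 f g H x z \<le> f z + r z *\<^sub>R L" if "z \<in> S" for z
    unfolding less_eq_vec_def using err[OF that] by (simp add: abs_le_iff algebra_simps)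
  have "phi F D f xp = F xp (f xp)"
    using SD[OF xp] by (simp add: phi_def)
  also have "\<dots> \<le> F xp (Omega2 f g H x xp) + ereal (r xp * s)"
    by (rule outer_perturbation[OF F_mono subhom sup(1) xp r f_le[OF xp]])
  also have "\<dots> \<le> F xp (Omega2 f g H x xp) + ereal (\<alpha> * s * bnorm B (xp - x) ^ 3 / 6)"
  proof -
    have "1 * (r xp * s) \<le> \<alpha> * (r xp * s)"
      using \<alpha> r sup(2) by (intro mult_right_mono) auto
    then show ?thesis
      by (intro add_left_mono) (simp add: r_def mult_ac)
  qed
  also have "\<dots> \<le> F y (Omega2 f g H x y) + ereal (\<alpha> * s * bnorm B (y - x) ^ 3 / 6)"
    using step y by (auto simp: is_arg_min_def not_less)
  also have "\<dots> \<le> (F y (f y) + ereal (r y * s)) + ereal (\<alpha> * s * bnorm B (y - x) ^ 3 / 6)"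
    by (intro add_right_mono outer_perturbation[OF F_mono subhom sup(1) y r model_le[OF y]])
  also have "\<dots> = phi F D f y + ereal ((1 + \<alpha>) * s / 6 * bnorm B (y - x) ^ 3)"
    using SD[OF y] by (simp add: phi_def r_def add.assoc algebra_simps add_divide_distrib)
  finally show ?thesis .
qed

section \<open>The rate of convergence\<close>

text \<open>
  With \<open>a = 3 / (n + 3)\<close> one has \<open>(n + 1) (n + 2) (n + 3) (1 - a) = n (n + 1) (n + 2)\<close>, so
  the weighted residuals \<open>n (n + 1) (n + 2) \<delta>\<^sub>n\<close> telescope, and the error
  \<open>(n + 1) (n + 2) (n + 3) a\<^sup>3 E\<close> of each step is at most \<open>27 E\<close>.
\<close>

lemma cubic_recursion_rate:
  fixes \<delta> :: "nat \<Rightarrow> real"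
  assumes rec: "\<And>n a. 0 \<le> a \<Longrightarrow> a \<le> 1 \<Longrightarrow> \<delta> (Suc n) \<le> (1 - a) * \<delta> n + a ^ 3 * E"
    and E: "0 \<le> E" and n: "1 \<le> n"
  shows "\<delta> n \<le> 27 * E / real n ^ 2"
proof -
  have weighted: "real n * (real n + 1) * (real n + 2) * \<delta> n \<le> 27 * E * real n" for n
  proof (induction n)
    case (Suc n)
    define m where "m = real n"
    define a where "a = 3 / (m + 3)"
    define A where "A = (m + 1) * (m + 2) * (m + 3)"
    have m: "0 \<le> m"
      by (simp add: m_def)
    have a: "0 \<le> a" "a \<le> 1"
      using m by (auto simp: a_def)
    have A: "0 \<le> A"
      using m by (simp add: A_def)
    have telescope: "A * (1 - a) = m * (m + 1) * (m + 2)"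
      using m by (simp add: A_def a_def field_simps)
    have "(m + 1) * (m + 2) * 27 \<le> (m + 3) * (m + 3) * 27"
      using m by (simp add: algebra_simps)
      moreover have "A * a ^ 3 = (m + 1) * (m + 2) * 27 / ((m + 3) * (m + 3))"
      using m by (simp add: A_def a_def power_divide power3_eq_cube)
    ultimately have error: "A * a ^ 3 \<le> 27"
      using m by (simp add: pos_divide_le_eq mult_ac)
    have "A * \<delta> (Suc n) \<le> A * ((1 - a) * \<delta> n + a ^ 3 * E)"
      using A rec[OF a] by (rule mult_left_mono[rotated])
    also have "\<dots> = m * (m + 1) * (m + 2) * \<delta> n + (A * a ^ 3) * E"
      unfolding telescope[symmetric] by (simp add: algebra_simps)
    also have "\<dots> \<le> 27 * E * m + 27 * E"
      using Suc.IH error E by (intro add_mono mult_right_mono) (auto simp: m_def)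
    finally show ?case
      by (simp add: A_def m_def algebra_simps)
  qed simp
  have pos: "0 < real n"
    using n by simp
  then have "(real n + 1) * (real n + 2) * \<delta> n \<le> 27 * E"
    using weighted[of n] by (simp add: mult_ac)
  then have "\<delta> n \<le> 27 * E / ((real n + 1) * (real n + 2))"
    using pos by (subst pos_le_divide_eq) (simp_all add: mult_ac)
  also have "\<dots> \<le> 27 * E / real n ^ 2"
    using pos E by (intro frac_le) (auto simp: power2_eq_square algebra_simps)
  finally show ?thesis .
qed

theorem theorem9:
  fixes B :: "'a::euclidean_space \<Rightarrow>\<^sub>L 'a \<Rightarrow>\<^sub>L real"
    and F :: "'a \<Rightarrow> real^'m \<Rightarrow> ereal"
    and D :: "'a set"
    and f :: "'a \<Rightarrow> real^'m"
    and g :: "'m \<Rightarrow> 'a \<Rightarrow> 'a \<Rightarrow>\<^sub>L real"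
    and H :: "'m \<Rightarrow> 'a \<Rightarrow> 'a \<Rightarrow>\<^sub>L 'a \<Rightarrow>\<^sub>L real"
    and L :: "real^'m"
    and xs :: 'a
    and x :: "nat \<Rightarrow> 'a"
    and \<alpha> :: real
    and M D0 :: ereal
    and k :: nat
  assumes B: "self_adjoint_op B" "pos_def_op B"
    and F_no_minf: "\<And>z u. F z u \<noteq> -\<infinity>"
    and F_closed_convex: "ext_closed_convex (\<lambda>(z, u). F z u)"
    and F_mono: "\<And>z. mono (F z)"
    and D: "open D" "convex D"
    and f_closed_convex: "\<And>i. closed_convex_on D (\<lambda>z. f z $ i)"
    and f_diff: "\<And>i. twice_cont_diff_on D (\<lambda>z. f z $ i) (g i) (H i)"
    and f_Lipschitz: "\<And>i y z. y \<in> D \<Longrightarrow> z \<in> D \<Longrightarrow>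
                        op_bnorm B (H i y - H i z) \<le> L $ i * bnorm B (y - z)"
    and minimizer: "is_arg_min (phi F D f) (\<lambda>y. y \<in> dom_phi F D f) xs"
    and subhom: "subhomogeneous_on (dom_phi F D f) F"
    and FL_finite: "sup_outer F (dom_phi F D f) L < \<infinity>"
    and x0: "x 0 \<in> dom_phi F D f"
    and D0_def: "D0 = (SUP z\<in>{z. phi F D f z \<le> phi F D f (x 0)}. ereal (bnorm B (z - xs)))"
    and D0_finite: "D0 < \<infinity>"
    and \<alpha>: "\<alpha> \<ge> 1"
    and M_def: "M = ereal \<alpha> * sup_outer F (dom_phi F D f) L"
    and step: "\<And>j. is_arg_min
                 (\<lambda>y. F y (Omega2 f g H (x j) y) + M / 6 * ereal (bnorm B (y - x j) ^ 3))
                 (\<lambda>y. y \<in> dom_phi F D f) (x (Suc j))"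
    and k: "k \<ge> 1"
  shows "phi F D f (x k) - phi F D f xs
           \<le> ereal (9 * (1 + \<alpha>)) * sup_outer F (dom_phi F D f) L * D0 ^ 3 / ereal (2 * real k ^ 2)"
proof -
  define S where "S = dom_phi F D f"
  define \<Phi> where "\<Phi> z = real_of_ereal (phi F D f z)" for z
  have SD: "z \<in> D" if "z \<in> S" for z
    using that by (simp add: S_def dom_phi_def)
  have xs: "xs \<in> S" and xs_min: "phi F D f xs \<le> phi F D f z" if "z \<in> S" for z
    using minimizer that by (auto simp: is_arg_min_def S_def not_less)
  note xs = xs[OF x0[folded S_def]]
  have \<Phi>: "phi F D f z = ereal (\<Phi> z)" if "z \<in> S" for z
    using subhom that SD[OF that]
    by (simp add: \<Phi>_def phi_def subhomogeneous_on_def S_def ereal_real')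
  have iter: "x j \<in> S" for j
    using x0 step[of "j - 1"] by (cases j) (auto simp: S_def is_arg_min_def)

  have "0 \<le> L $ i" for i
    using Lipschitz_const_nonneg[OF B(2) D(1) _ f_Lipschitz, of i] SD[OF xs] by blast
  then have "0 \<le> L"
    by (simp add: less_eq_vec_def)
  then have "0 \<le> sup_outer F S L"
    using sup_outer_nonneg[OF F_mono subhom] xs by (simp add: S_def)
  then obtain s where s: "sup_outer F S L = ereal s" "0 \<le> s"
    using FL_finite by (cases "sup_outer F S L") (auto simp: S_def)

  have D0_upper: "ereal (bnorm B (z - xs)) \<le> D0" if "phi F D f z \<le> phi F D f (x 0)" for z
    unfolding D0_def using that by (intro SUP_upper) simp
  have "0 \<le> D0"
    using D0_upper[OF xs_min[OF iter]] by (simp add: bnorm_def zero_ereal_def)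
  then obtain R where R: "D0 = ereal R" "0 \<le> R"
    using D0_finite by (cases D0) auto

  have step_le: "\<Phi> (x (Suc j)) \<le> \<Phi> y + (1 + \<alpha>) * s / 6 * bnorm B (y - x j) ^ 3" if "y \<in> S" for y j
  proof -
    have "M / 6 * ereal c = ereal (\<alpha> * s * c / 6)" for c
    proof -
      have "M / 6 = ereal (\<alpha> * s) / ereal 6"
        using s by (simp add: M_def S_def)
      then show ?thesis
        by simp
    qed
    then have "is_arg_min (\<lambda>y. F y (Omega2 f g H (x j) y) + ereal (\<alpha> * s * bnorm B (y - x j) ^ 3 / 6))
                 (\<lambda>y. y \<in> dom_phi F D f) (x (Suc j))"
      using step[of j] by simp
    from cubic_step_bound[OF B(2) F_mono D(2) f_diff f_Lipschitz subhom s(1)[unfolded S_def] s(2) \<alpha>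
        this iter[of j, unfolded S_def] that[unfolded S_def]]
    show ?thesis
      using \<Phi>[OF iter] \<Phi>[OF that] by simp
  qed
  have level: "\<Phi> (x j) \<le> \<Phi> (x 0)" for j
  proof (induction j)
    case (Suc j)
    then show ?case
      using step_le[OF iter[of j], of j] by (simp add: bnorm_def)
  qed simp
  have near: "bnorm B (x j - xs) \<le> R" for j
    using D0_upper[of "x j"] level[of j] \<Phi>[OF iter] by (simp add: R)

  define E where "E = (1 + \<alpha>) * s / 6 * R ^ 3"
  have E: "0 \<le> E"
    using \<alpha> s R by (simp add: E_def)
  have rec: "\<Phi> (x (Suc j)) - \<Phi> xs \<le> (1 - a) * (\<Phi> (x j) - \<Phi> xs) + a ^ 3 * E"
    if a: "0 \<le> a" "a \<le> 1" for j a
  proof -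
    define y where "y = (1 - a) *\<^sub>R x j + a *\<^sub>R xs"
    have phi_y: "phi F D f y \<le> ereal ((1 - a) * \<Phi> (x j) + a * \<Phi> xs)"
      unfolding y_def using f_closed_convex
      by (intro phi_convex[OF F_closed_convex F_mono D(2)] SD \<Phi> iter xs a)
        (simp add: closed_convex_on_def)
    have "y \<in> D"
      unfolding y_def by (rule convexD_alt[OF D(2) SD[OF iter] SD[OF xs] a])
    moreover have "phi F D f y < \<infinity>"
      using phi_y by (rule le_less_trans) simp
    ultimately have y: "y \<in> S"
      by (simp add: S_def dom_phi_def phi_def)
    have "y - x j = (- a) *\<^sub>R (x j - xs)"
      by (simp add: y_def algebra_simps)
    then have "bnorm B (y - x j) = a * bnorm B (x j - xs)"
      using a by (simp add: bnorm_scaleR del: scaleR_minus_left)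
    also have "\<dots> \<le> a * R"
      using a near by (intro mult_left_mono)
    finally have "bnorm B (y - x j) ^ 3 \<le> (a * R) ^ 3"
      by (intro power_mono bnorm_nonneg B)
    then have "(1 + \<alpha>) * s / 6 * bnorm B (y - x j) ^ 3 \<le> (1 + \<alpha>) * s / 6 * (a * R) ^ 3"
      using \<alpha> s by (intro mult_left_mono) auto
    also have "\<dots> = a ^ 3 * E"
      by (simp add: E_def power_mult_distrib)
    finally have "\<Phi> (x (Suc j)) \<le> \<Phi> y + a ^ 3 * E"
      using step_le[OF y, of j] by simp
    moreover have "\<Phi> y \<le> (1 - a) * \<Phi> (x j) + a * \<Phi> xs"
      using phi_y \<Phi>[OF y] by simp
    ultimately show ?thesis
      by (simp add: algebra_simps)
  qed
  have "\<Phi> (x k) - \<Phi> xs \<le> 27 * E / real k ^ 2"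
    using rec E k by (rule cubic_recursion_rate)
  also have "\<dots> = 9 * (1 + \<alpha>) * s * R ^ 3 / (2 * real k ^ 2)"
    by (simp add: E_def)
  finally show ?thesis
    using k s R \<Phi>[OF iter] \<Phi>[OF xs] by (simp flip: S_def)
qed

end
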